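(* Let $n\ge2$ and let $A=(a_{ij})\in\mathbb{M}(n)$ be a nonnegative matrix. Let $X=(x_{jk})\in\mathbb{M}(n)$ with $x_{jk}=\min\{a_{jk},a_{kj}\}$. Then $$\rho(A)\ \ge\ \frac{b_{11}+b_{22}}{2}+\sqrt{\frac{\operatorname{tr}X^2}{n}-\left(\frac{\operatorname{tr}X}{n}\right)^2},$$ where $b_{11}$ and $b_{22}$ are respectively the first and the second smallest diagonal entries of $A$ and $\operatorname{tr}X$ denotes the trace of $X$.
   Context: $\mathbb{M}(n)$ is the algebra of all $n\times n$ complex matrices. A matrix $A=(a_{ij})$ is nonnegative if $a_{ij}\ge0$ for all $i,j$ (entrywise); $A$ is not assumed symmetric. $\rho(A)=\max\{|\lambda|:\lambda\in\sigma(A)\}$ is the spectral radius, where $\sigma(A)$ is the spectrum of $A$. The smallest diagonal entries are counted with multiplicity. *)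

theory Defs
  imports "Jordan_Normal_Form.Spectral_Radius" "HOL-Library.Complex_Order"
begin

(* The order on complex used here is that of Complex_Order: 0 <= z means that
   z is real and nonnegative. *)
definition nonneg_mat :: "complex mat \<Rightarrow> bool" where
  "nonneg_mat A \<longleftrightarrow> (\<forall>i < dim_row A. \<forall>j < dim_col A. 0 \<le> A $$ (i, j))"

definition mat_trace :: "'a :: comm_monoid_add mat \<Rightarrow> 'a" where
  "mat_trace A = (\<Sum>i < dim_row A. A $$ (i, i))"

(* Diagonal entries in increasing order, repeated according to multiplicity,
   so index 0 gives the smallest one and index 1 the second smallest. Taking
   Re loses nothing on the nonnegative matrices this is meant for. *)
definition sorted_diag :: "complex mat \<Rightarrow> real list" where
  "sorted_diag A = sort (map Re (diag_mat A))"

(* Entrywise minimum of A and its transpose. The complex order is only partial,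
   so the minimum is taken of the real parts; for nonnegative A these are the
   entries themselves. *)
definition min_transpose :: "complex mat \<Rightarrow> complex mat" where
  "min_transpose A = mat (dim_row A) (dim_col A)
     (\<lambda>(j, k). complex_of_real (min (Re (A $$ (j, k))) (Re (A $$ (k, j)))))"

end

theory Submission
  imports Defs "HOL-Analysis.Convex" "HOL-Combinatorics.Permutations"
begin

text \<open>
  The matrix \<open>X\<close> is real, symmetric and nonnegative, it lies entrywise below \<open>A\<close>, and it has the
  diagonal of \<open>A\<close>. Write \<open>\<rho>\<close> for the spectral radius of \<open>A\<close> and let \<open>m\<close> be the smallest eigenvalue
  of \<open>X\<close>. The bound is the sum of two estimates, using \<open>\<rho> = (\<rho> + m) / 2 + (\<rho> - m) / 2\<close>.

  Both rest on the fact that the quadratic form of \<open>X\<close> is at most \<open>\<rho>\<close> times the squared norm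
  (\<open>quad_form_le_spectral_radius\<close>). If some unit vector \<open>f\<close> violated it, then, after rescaling so that
  \<open>\<rho> < 1 < \<langle>f, X f\<rangle>\<close>, the Cauchy-Schwarz inequality would make \<open>\<langle>f, X^k f\<rangle>\<close> grow without bound along
  the powers of two; but it is dominated by the entries of \<open>A^k\<close>, which stay bounded when \<open>\<rho> < 1\<close>.

  In particular all eigenvalues of \<open>X\<close> lie in the interval from \<open>m\<close> to \<open>\<rho>\<close>. The quantity under the
  square root is their variance, and a distribution on an interval has standard deviation at
  most half its length (\<open>sqrt_variance_le_half_range\<close>, Popoviciu's inequality). So the square root
  is at most \<open>(\<rho> - m) / 2\<close>.

  It remains to see that \<open>\<rho> + m\<close> is at least the sum of the two smallest diagonal entries
  (\<open>extreme_eigenvalues_sum_ge\<close>). For a unit eigenvector \<open>v\<close> of \<open>m\<close> and any unit vector \<open>f\<close>, the sum of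
  the quadratic form at \<open>f\<close> and at \<open>v\<close> is at most \<open>\<rho> + m\<close>. A suitable \<open>f\<close> makes the joint
  off-diagonal contribution nonnegative and gives the smallest diagonal entry a total weight of at
  most \<open>1\<close> out of \<open>2\<close>.
\<close>

section \<open>Real symmetric kernels and their quadratic forms\<close>

definition apply_kernel :: "nat \<Rightarrow> (nat \<Rightarrow> nat \<Rightarrow> real) \<Rightarrow> (nat \<Rightarrow> real) \<Rightarrow> nat \<Rightarrow> real" where
  "apply_kernel n x f i = (\<Sum>j<n. x i j * f j)"

definition quad_form :: "nat \<Rightarrow> (nat \<Rightarrow> nat \<Rightarrow> real) \<Rightarrow> (nat \<Rightarrow> real) \<Rightarrow> real" where
  "quad_form n x f = (\<Sum>i<n. f i * apply_kernel n x f i)"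

lemma apply_kernel_selfadjoint:
  assumes "\<And>i j. i < n \<Longrightarrow> j < n \<Longrightarrow> x i j = x j i"
  shows "(\<Sum>i<n. f i * apply_kernel n x g i) = (\<Sum>i<n. apply_kernel n x f i * g i)"
proof -
  have "(\<Sum>i<n. f i * apply_kernel n x g i) = (\<Sum>i<n. \<Sum>j<n. f i * (x i j * g j))"
    by (simp add: apply_kernel_def sum_distrib_left)
  also have "\<dots> = (\<Sum>j<n. \<Sum>i<n. f i * (x i j * g j))"
    by (rule sum.swap)
  also have "\<dots> = (\<Sum>j<n. \<Sum>i<n. x j i * f i * g j)"
    using assms by (intro sum.cong refl) auto
  finally show ?thesis by (simp add: apply_kernel_def sum_distrib_right)
qed

lemma funpow_apply_kernel_selfadjoint:
  assumes "\<And>i j. i < n \<Longrightarrow> j < n \<Longrightarrow> x i j = x j i"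
  shows "(\<Sum>i<n. f i * (apply_kernel n x ^^ k) g i) = (\<Sum>i<n. (apply_kernel n x ^^ k) f i * g i)"
proof (induction k arbitrary: f)
  case (Suc k)
  have "(\<Sum>i<n. f i * (apply_kernel n x ^^ Suc k) g i)
      = (\<Sum>i<n. apply_kernel n x f i * (apply_kernel n x ^^ k) g i)"
    using apply_kernel_selfadjoint[OF assms] by simp
  also have "\<dots> = (\<Sum>i<n. (apply_kernel n x ^^ Suc k) f i * g i)"
    unfolding Suc.IH by (simp add: funpow_swap1)
  finally show ?case .
qed simp

lemma quad_form_eigenvector:
  assumes "\<And>i. i < n \<Longrightarrow> apply_kernel n x v i = m * v i"
  shows "quad_form n x v = m * (\<Sum>i<n. (v i)\<^sup>2)"
  unfolding quad_form_def sum_distrib_left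
  by (intro sum.cong refl) (simp add: assms power2_eq_square)

text \<open>
  For the eigenvector \<open>g\<close> of the smallest eigenvalue the off-diagonal products have unknown sign.
  A second vector \<open>f\<close> can compensate them, and then only the diagonal matters.
\<close>

lemma quad_form_combination_ge_diagonal:
  assumes nonneg: "\<And>i j. i < n \<Longrightarrow> j < n \<Longrightarrow> 0 \<le> x i j"
    and off: "\<And>i j. i < n \<Longrightarrow> j < n \<Longrightarrow> i \<noteq> j \<Longrightarrow> 0 \<le> f i * f j + s * (g i * g j)"
  shows "(\<Sum>i<n. x i i * ((f i)\<^sup>2 + s * (g i)\<^sup>2)) \<le> quad_form n x f + s * quad_form n x g"
proof -
  have form: "quad_form n x h = (\<Sum>i<n. \<Sum>j<n. x i j * (h i * h j))" for h
    unfolding quad_form_def apply_kernel_def sum_distrib_left by (simp only: mult.left_commute)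
  have "quad_form n x f + s * quad_form n x g
      = (\<Sum>i<n. \<Sum>j<n. x i j * (f i * f j + s * (g i * g j)))"
    unfolding form sum_distrib_left sum.distrib[symmetric]
    by (simp only: distrib_left mult.left_commute)
  moreover have "x i i * ((f i)\<^sup>2 + s * (g i)\<^sup>2) \<le> (\<Sum>j<n. x i j * (f i * f j + s * (g i * g j)))"
    if i: "i < n" for i
  proof -
    have "(\<Sum>j<n. x i j * (f i * f j + s * (g i * g j)))
        = x i i * ((f i)\<^sup>2 + s * (g i)\<^sup>2) + (\<Sum>j\<in>{..<n}-{i}. x i j * (f i * f j + s * (g i * g j)))"
      using i by (subst sum.remove[of _ i]) (auto simp: power2_eq_square)
    moreover have "0 \<le> (\<Sum>j\<in>{..<n}-{i}. x i j * (f i * f j + s * (g i * g j)))"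
      using i nonneg off by (intro sum_nonneg mult_nonneg_nonneg) auto
    ultimately show ?thesis by simp
  qed
  ultimately show ?thesis by (auto intro: sum_mono)
qed

section \<open>The spectral radius dominates the quadratic form\<close>

lemma nonneg_mat_pow:
  assumes A: "A \<in> carrier_mat n n" and "nonneg_mat A" and "i < n" "j < n"
  shows "0 \<le> (A ^\<^sub>m k) $$ (i, j)"
  using assms(3,4)
proof (induction k arbitrary: i j)
  case 0
  then show ?case using A by (simp add: less_eq_complex_def)
next
  case (Suc k)
  have "(A ^\<^sub>m Suc k) $$ (i, j) = (\<Sum>l = 0..<n. (A ^\<^sub>m k) $$ (i, l) * A $$ (l, j))"
    using A Suc.prems by (simp add: scalar_prod_def)
  also have "0 \<le> \<dots>"
    using A Suc assms(2) by (intro sum_nonneg mult_nonneg_nonneg) (auto simp: nonneg_mat_def)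
  finally show ?case .
qed

text \<open>Entrywise domination passes to powers because all entries are nonnegative.\<close>

lemma abs_funpow_apply_kernel_le:
  assumes A: "A \<in> carrier_mat n n" and "nonneg_mat A"
    and nonneg: "\<And>i j. i < n \<Longrightarrow> j < n \<Longrightarrow> 0 \<le> x i j"
    and le: "\<And>i j. i < n \<Longrightarrow> j < n \<Longrightarrow> x i j \<le> Re (A $$ (i, j))"
    and i: "i < n"
  shows "\<bar>(apply_kernel n x ^^ k) f i\<bar> \<le> (\<Sum>j<n. Re ((A ^\<^sub>m k) $$ (i, j)) * \<bar>f j\<bar>)"
proof (induction k arbitrary: f)
  case 0
  have "(\<Sum>j<n. Re ((A ^\<^sub>m 0) $$ (i, j)) * \<bar>f j\<bar>) = (\<Sum>j<n. if i = j then \<bar>f j\<bar> else 0)"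
    using A i by (intro sum.cong) auto
  then show ?case using i by simp
next
  case (Suc k)
  let ?P = "\<lambda>i j. Re ((A ^\<^sub>m k) $$ (i, j))"
  have P: "0 \<le> ?P i l" "Im ((A ^\<^sub>m k) $$ (i, l)) = 0" if "l < n" for l
    using nonneg_mat_pow[OF A assms(2) i that, of k] by (auto simp: less_eq_complex_def)
  have "\<bar>(apply_kernel n x ^^ Suc k) f i\<bar> = \<bar>(apply_kernel n x ^^ k) (apply_kernel n x f) i\<bar>"
    by (simp add: funpow_swap1)
  also have "\<dots> \<le> (\<Sum>l<n. ?P i l * \<bar>apply_kernel n x f l\<bar>)"
    by (rule Suc.IH)
  also have "\<dots> \<le> (\<Sum>l<n. ?P i l * (\<Sum>j<n. Re (A $$ (l, j)) * \<bar>f j\<bar>))"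
  proof (intro sum_mono mult_left_mono)
    fix l assume l: "l \<in> {..<n}"
    have "\<bar>apply_kernel n x f l\<bar> \<le> (\<Sum>j<n. \<bar>x l j * f j\<bar>)"
      unfolding apply_kernel_def by (rule sum_abs)
    also have "\<dots> \<le> (\<Sum>j<n. Re (A $$ (l, j)) * \<bar>f j\<bar>)"
      using l nonneg le by (intro sum_mono) (auto simp: abs_mult intro!: mult_right_mono)
    finally show "\<bar>apply_kernel n x f l\<bar> \<le> \<dots>" .
  qed (use P in auto)
  also have "\<dots> = (\<Sum>l<n. \<Sum>j<n. ?P i l * Re (A $$ (l, j)) * \<bar>f j\<bar>)"
    by (simp add: sum_distrib_left mult.assoc)
  also have "\<dots> = (\<Sum>j<n. \<Sum>l<n. ?P i l * Re (A $$ (l, j)) * \<bar>f j\<bar>)"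
    by (rule sum.swap)
  also have "\<dots> = (\<Sum>j<n. Re ((A ^\<^sub>m Suc k) $$ (i, j)) * \<bar>f j\<bar>)"
  proof (intro sum.cong refl)
    fix j assume j: "j \<in> {..<n}"
    have "Re ((A ^\<^sub>m Suc k) $$ (i, j)) = (\<Sum>l<n. ?P i l * Re (A $$ (l, j)))"
      using A i j P(2) by (simp add: scalar_prod_def lessThan_atLeast0)
    then show "(\<Sum>l<n. ?P i l * Re (A $$ (l, j)) * \<bar>f j\<bar>) = Re ((A ^\<^sub>m Suc k) $$ (i, j)) * \<bar>f j\<bar>"
      by (simp add: sum_distrib_right)
  qed
  finally show ?case .
qed

text \<open>
  By self-adjointness and Cauchy-Schwarz, \<open>s k = \<langle>f, X^k f\<rangle>\<close> satisfies \<open>(s k)\<^sup>2 \<le> s 0 * s (2 * k)\<close>.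
  Hence \<open>q = s 1 / s 0 > 1\<close> would force \<open>s (2^k) \<ge> q^(2^k) * s 0\<close>, which is unbounded. This replaces
  a diagonalisation of \<open>X\<close>.
\<close>

lemma quad_form_le_of_bounded_iterates:
  assumes sym: "\<And>i j. i < n \<Longrightarrow> j < n \<Longrightarrow> x i j = x j i"
    and bounded: "\<And>k. (\<Sum>i<n. f i * (apply_kernel n x ^^ k) f i) \<le> C"
  shows "quad_form n x f \<le> (\<Sum>i<n. (f i)\<^sup>2)"
proof (rule ccontr)
  define s where "s k = (\<Sum>i<n. f i * (apply_kernel n x ^^ k) f i)" for k
  assume "\<not> ?thesis"
  moreover have s0: "s 0 = (\<Sum>i<n. (f i)\<^sup>2)" and s1: "s 1 = quad_form n x f"
    by (simp_all add: s_def quad_form_def power2_eq_square)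
  ultimately have less: "s 0 < s 1" by simp
  have "s 0 \<noteq> 0"
  proof
    assume "s 0 = 0"
    then have "\<forall>i\<in>{..<n}. (f i)\<^sup>2 = 0"
      unfolding s0 by (subst (asm) sum_nonneg_eq_0_iff) auto
    then have "s 1 = 0" by (simp add: s1[simplified] quad_form_def)
    with less \<open>s 0 = 0\<close> show False by simp
  qed
  then have pos: "s 0 > 0"
    using s0 by (metis order_le_less sum_nonneg zero_le_power2)
  have double: "(s k)\<^sup>2 \<le> s 0 * s (k + k)" for k
  proof -
    have "(s k)\<^sup>2 \<le> (\<Sum>i<n. (f i)\<^sup>2) * (\<Sum>i<n. ((apply_kernel n x ^^ k) f i)\<^sup>2)"
      unfolding s_def by (rule Cauchy_Schwarz_ineq_sum)
    also have "(\<Sum>i<n. ((apply_kernel n x ^^ k) f i)\<^sup>2) = s (k + k)"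
      unfolding s_def funpow_add o_def
      by (subst funpow_apply_kernel_selfadjoint[OF sym]) (auto simp: power2_eq_square)
    finally show ?thesis by (simp add: s0)
  qed
  define q where "q = s 1 / s 0"
  have q: "q > 1" using less pos by (simp add: q_def)
  have growth: "q ^ (2 ^ k) * s 0 \<le> s (2 ^ k)" for k
  proof (induction k)
    case 0
    then show ?case using pos by (simp add: q_def)
  next
    case (Suc k)
    have "(q ^ (2 ^ k) * s 0)\<^sup>2 \<le> (s (2 ^ k))\<^sup>2"
      using Suc pos q by (intro power_mono) auto
    also have "\<dots> \<le> s 0 * s (2 ^ Suc k)"
      using double[of "2 ^ k"] by (simp add: mult_2)
    finally have "s 0 * (q ^ (2 ^ Suc k) * s 0) \<le> s 0 * s (2 ^ Suc k)"
      by (simp add: power2_eq_square power_add mult_2 algebra_simps)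
    then show ?case using pos by simp
  qed
  obtain k where k: "C / s 0 < q ^ k"
    using real_arch_pow[OF q] by blast
  also have "q ^ k \<le> q ^ (2 ^ k)"
    using q by (intro power_increasing) auto
  finally have "C < q ^ (2 ^ k) * s 0"
    using pos by (simp add: field_simps)
  with growth[of k] bounded[of "2 ^ k"] show False
    by (simp add: s_def)
qed

lemma quad_form_le_if_spectral_radius_less_1:
  assumes A: "A \<in> carrier_mat n n" and "nonneg_mat A" and sr: "spectral_radius A < 1"
    and sym: "\<And>i j. i < n \<Longrightarrow> j < n \<Longrightarrow> x i j = x j i"
    and nonneg: "\<And>i j. i < n \<Longrightarrow> j < n \<Longrightarrow> 0 \<le> x i j"
    and le: "\<And>i j. i < n \<Longrightarrow> j < n \<Longrightarrow> x i j \<le> Re (A $$ (i, j))"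
  shows "quad_form n x f \<le> (\<Sum>i<n. (f i)\<^sup>2)"
proof -
  obtain c where c: "\<And>k. norm_bound (A ^\<^sub>m k) c"
    using spectral_radius_jnf_norm_bound_less_1_upper_triangular[OF A sr] by blast
  have "(\<Sum>i<n. f i * (apply_kernel n x ^^ k) f i) \<le> (\<Sum>i<n. \<bar>f i\<bar> * (\<Sum>j<n. c * \<bar>f j\<bar>))" for k
  proof (rule sum_mono)
    fix i assume i: "i \<in> {..<n}"
    have "f i * (apply_kernel n x ^^ k) f i \<le> \<bar>f i\<bar> * \<bar>(apply_kernel n x ^^ k) f i\<bar>"
      by (metis abs_ge_self abs_mult)
    also have "\<dots> \<le> \<bar>f i\<bar> * (\<Sum>j<n. Re ((A ^\<^sub>m k) $$ (i, j)) * \<bar>f j\<bar>)"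
      using i by (intro mult_left_mono abs_funpow_apply_kernel_le A assms(2) nonneg le) auto
    also have "\<dots> \<le> \<bar>f i\<bar> * (\<Sum>j<n. c * \<bar>f j\<bar>)"
    proof (intro mult_left_mono sum_mono mult_right_mono)
      fix j assume "j \<in> {..<n}"
      with i A c[of k] have "norm ((A ^\<^sub>m k) $$ (i, j)) \<le> c"
        by (auto simp: norm_bound_def)
      then show "Re ((A ^\<^sub>m k) $$ (i, j)) \<le> c"
        using complex_Re_le_cmod order_trans by blast
    qed auto
    finally show "f i * (apply_kernel n x ^^ k) f i \<le> \<bar>f i\<bar> * (\<Sum>j<n. c * \<bar>f j\<bar>)" .
  qed
  from quad_form_le_of_bounded_iterates[OF sym this] show ?thesis .
qed

lemma spectral_radius_nonneg:
  assumes "A \<in> carrier_mat n n" "n > 0"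
  shows "0 \<le> spectral_radius A"
  using spectral_radius_mem_max(1)[OF assms] by auto

lemma spectral_radius_scaled_less_1:
  assumes A: "A \<in> carrier_mat n n" and n: "n > 0" and t: "spectral_radius A < t"
  shows "spectral_radius (complex_of_real (1 / t) \<cdot>\<^sub>m A) < 1"
proof -
  have t0: "t > 0" using spectral_radius_nonneg[OF A n] t by simp
  let ?B = "complex_of_real (1 / t) \<cdot>\<^sub>m A"
  have B: "?B \<in> carrier_mat n n" using A by simp
  obtain \<mu> where \<mu>: "\<mu> \<in> spectrum ?B" and sr: "spectral_radius ?B = norm \<mu>"
    using spectral_radius_mem_max(1)[OF B n] by auto
  obtain v where v: "v \<in> carrier_vec n" "v \<noteq> 0\<^sub>v n" and eq: "?B *\<^sub>v v = \<mu> \<cdot>\<^sub>v v"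
    using \<mu> A by (auto simp: spectrum_def eigenvalue_def eigenvector_def)
  have "A *\<^sub>v v = complex_of_real t \<cdot>\<^sub>v (?B *\<^sub>v v)"
    using A v(1) t0 by (intro eq_vecI) auto
  then have "A *\<^sub>v v = (complex_of_real t * \<mu>) \<cdot>\<^sub>v v"
    unfolding eq by (simp add: smult_smult_assoc)
  then have "complex_of_real t * \<mu> \<in> spectrum A"
    using A v by (auto simp: spectrum_def eigenvalue_def eigenvector_def)
  then have "norm (complex_of_real t * \<mu>) \<le> spectral_radius A"
    using spectral_radius_mem_max(2)[OF A n] by blast
  moreover have "norm (complex_of_real t * \<mu>) = t * norm \<mu>"
    using t0 by (simp add: norm_mult)
  ultimately have "t * norm \<mu> < t * 1"
    using t by linarith
  then show ?thesis using t0 unfolding sr by (simp only: mult_less_cancel_left_pos)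
qed

text \<open>
  Rescaling by any \<open>t\<close> above the spectral radius reduces this to the previous case; then \<open>t\<close> tends
  to the spectral radius.
\<close>

lemma quad_form_le_spectral_radius:
  assumes A: "A \<in> carrier_mat n n" and n: "n > 0" and "nonneg_mat A"
    and sym: "\<And>i j. i < n \<Longrightarrow> j < n \<Longrightarrow> x i j = x j i"
    and nonneg: "\<And>i j. i < n \<Longrightarrow> j < n \<Longrightarrow> 0 \<le> x i j"
    and le: "\<And>i j. i < n \<Longrightarrow> j < n \<Longrightarrow> x i j \<le> Re (A $$ (i, j))"
  shows "quad_form n x f \<le> spectral_radius A * (\<Sum>i<n. (f i)\<^sup>2)"
proof (rule field_le_epsilon)
  fix \<epsilon> :: real assume \<epsilon>: "\<epsilon> > 0"
  let ?S = "\<Sum>i<n. (f i)\<^sup>2"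
  have S: "?S \<ge> 0" by (simp add: sum_nonneg)
  \<comment> \<open>The denominator absorbs the factor \<open>?S\<close>, and the added \<open>1\<close> covers \<open>?S = 0\<close>.\<close>
  define t where "t = spectral_radius A + \<epsilon> / (?S + 1)"
  have t: "spectral_radius A < t" using \<epsilon> S by (simp add: t_def)
  then have t0: "t > 0" using spectral_radius_nonneg[OF A n] by simp
  let ?B = "complex_of_real (1 / t) \<cdot>\<^sub>m A"
  have "quad_form n (\<lambda>i j. x i j / t) f \<le> ?S"
  proof (rule quad_form_le_if_spectral_radius_less_1)
    show "?B \<in> carrier_mat n n" using A by simp
    show "nonneg_mat ?B"
      using assms(3) t0 by (auto simp: nonneg_mat_def less_eq_complex_def)
    show "spectral_radius ?B < 1" by (rule spectral_radius_scaled_less_1[OF A n t])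
  qed (use A sym nonneg le t0 in \<open>auto simp: divide_right_mono\<close>)
  moreover have "quad_form n (\<lambda>i j. x i j / t) f = quad_form n x f / t"
    by (simp add: quad_form_def apply_kernel_def sum_divide_distrib sum_distrib_left)
  ultimately have "quad_form n x f \<le> t * ?S"
    using t0 by (simp add: field_simps)
  also have "\<dots> = spectral_radius A * ?S + \<epsilon> * (?S / (?S + 1))"
    by (simp add: t_def algebra_simps)
  also have "\<dots> \<le> spectral_radius A * ?S + \<epsilon>"
  proof (intro add_left_mono)
    have "?S / (?S + 1) \<le> 1" using S by simp
    then show "\<epsilon> * (?S / (?S + 1)) \<le> \<epsilon>" using \<epsilon> mult_left_le by fastforce
  qed
  finally show "quad_form n x f \<le> spectral_radius A * ?S + \<epsilon>" .
qed

section \<open>Eigenvalues of a real symmetric matrix\<close>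

lemma mat_trace_mult_commute:
  fixes A B :: "'a :: comm_semiring_0 mat"
  assumes "A \<in> carrier_mat n m" "B \<in> carrier_mat m n"
  shows "mat_trace (A * B) = mat_trace (B * A)"
proof -
  have "mat_trace (A * B) = (\<Sum>i<n. \<Sum>j<m. A $$ (i, j) * B $$ (j, i))"
    using assms by (simp add: mat_trace_def scalar_prod_def lessThan_atLeast0)
  also have "\<dots> = (\<Sum>j<m. \<Sum>i<n. A $$ (i, j) * B $$ (j, i))"
    by (rule sum.swap)
  also have "\<dots> = mat_trace (B * A)"
    using assms by (simp add: mat_trace_def scalar_prod_def lessThan_atLeast0 mult.commute)
  finally show ?thesis .
qed

lemma mat_trace_similar:
  fixes A B :: "'a :: comm_ring_1 mat"
  assumes A: "A \<in> carrier_mat n n" and "similar_mat_wit A B P Q"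
  shows "mat_trace A = mat_trace B"
proof -
  note w = similar_mat_witD2[OF A assms(2)]
  have "mat_trace A = mat_trace (Q * (P * B))"
    unfolding w(3) by (rule mat_trace_mult_commute) (use w in auto)
  also have "Q * (P * B) = (Q * P) * B"
    using w by (intro assoc_mult_mat[symmetric]) auto
  also have "\<dots> = B" using w by simp
  finally show ?thesis .
qed

text \<open>
  A Schur triangularisation carries the eigenvalues on its diagonal, and squaring a triangular matrix
  squares the diagonal.
\<close>

lemma traces_eq_eigenvalue_sums:
  fixes X :: "complex mat"
  assumes X: "X \<in> carrier_mat n n"
  obtains e where "mat_trace X = (\<Sum>i<n. e i)" "mat_trace (X ^\<^sub>m 2) = (\<Sum>i<n. (e i)\<^sup>2)"
    "\<And>i. i < n \<Longrightarrow> eigenvalue X (e i)"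
proof -
  obtain es where es: "char_poly X = (\<Prod>a\<leftarrow>es. [:- a, 1:])" "length es = n"
    using char_poly_factorized[OF X] by blast
  obtain B P Q where "schur_decomposition X es = (B, P, Q)"
    by (metis prod_cases3)
  from schur_decomposition[OF X es(1) this]
  have sim: "similar_mat_wit X B P Q" and ut: "upper_triangular B" and diag: "diag_mat B = es"
    by auto
  have B: "B \<in> carrier_mat n n" using similar_mat_witD2[OF X sim] by simp
  have entry: "B $$ (i, i) = es ! i" if "i < n" for i
    using that B diag by (auto simp: diag_mat_def)
  have square: "(B * B) $$ (i, i) = (es ! i)\<^sup>2" if i: "i < n" for i
  proof -
    have "(B * B) $$ (i, i) = (\<Sum>l\<in>{0..<n}. B $$ (i, l) * B $$ (l, i))"
      using B i by (simp add: scalar_prod_def)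
    also have "\<dots> = (\<Sum>l\<in>{0..<n}. if l = i then (es ! i)\<^sup>2 else 0)"
    proof (intro sum.cong refl)
      fix l assume "l \<in> {0..<n}"
      then show "B $$ (i, l) * B $$ (l, i) = (if l = i then (es ! i)\<^sup>2 else 0)"
        using upper_triangularD[OF ut, of l i] upper_triangularD[OF ut, of i l] entry[of i] B i
        by (cases l i rule: linorder_cases) (auto simp: power2_eq_square)
    qed
    finally show ?thesis using i by simp
  qed
  have "mat_trace X = (\<Sum>i<n. es ! i)"
    unfolding mat_trace_similar[OF X sim] using B entry by (simp add: mat_trace_def)
  moreover have "mat_trace (X ^\<^sub>m 2) = (\<Sum>i<n. (es ! i)\<^sup>2)"
  proof -
    have "similar_mat_wit (X ^\<^sub>m 2) (B ^\<^sub>m 2) P Q"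
      by (rule similar_mat_wit_pow[OF sim])
    then have "mat_trace (X ^\<^sub>m 2) = mat_trace (B ^\<^sub>m 2)"
      using X by (intro mat_trace_similar) auto
    also have "B ^\<^sub>m 2 = B * B" using B by (simp add: numeral_2_eq_2)
    finally show ?thesis using B square by (simp add: mat_trace_def)
  qed
  moreover have "eigenvalue X (es ! i)" if "i < n" for i
    unfolding eigenvalue_root_char_poly[OF X] es(1)
    using that es(2) by (intro linear_poly_root) auto
  ultimately show ?thesis by (rule that)
qed

text \<open>
  Split an eigenvector as \<open>a + \<i> b\<close>. Comparing \<open>\<langle>b, X a\<rangle>\<close> with \<open>\<langle>X b, a\<rangle>\<close> shows that the eigenvalue is
  real, so \<open>a\<close> and \<open>b\<close> both satisfy the eigenvector equation, and one of them is nonzero.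
\<close>

lemma real_eigenpair_of_symmetric:
  assumes sym: "\<And>i j. i < n \<Longrightarrow> j < n \<Longrightarrow> x i j = x j i"
    and ev: "eigenvalue (mat n n (\<lambda>(i, j). complex_of_real (x i j))) e"
  obtains v where "Im e = 0" "\<And>i. i < n \<Longrightarrow> apply_kernel n x v i = Re e * v i"
    "0 < (\<Sum>i<n. (v i)\<^sup>2)"
proof -
  let ?X = "mat n n (\<lambda>(i, j). complex_of_real (x i j))"
  obtain u where u: "u \<in> carrier_vec n" "u \<noteq> 0\<^sub>v n" and eq: "?X *\<^sub>v u = e \<cdot>\<^sub>v u"
    using ev by (auto simp: eigenvalue_def eigenvector_def)
  define a where "a i = Re (u $ i)" for i
  define b where "b i = Im (u $ i)" for i
  have comp: "(\<Sum>j<n. complex_of_real (x i j) * u $ j) = e * u $ i" if "i < n" for i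
  proof -
    have "(?X *\<^sub>v u) $ i = (e \<cdot>\<^sub>v u) $ i" using eq by simp
    then show ?thesis using that u(1)
      by (simp add: scalar_prod_def lessThan_atLeast0)
  qed
  have re: "apply_kernel n x a i = Re e * a i - Im e * b i" if "i < n" for i
    using arg_cong[OF comp[OF that], of Re] by (simp add: apply_kernel_def a_def b_def)
  have im: "apply_kernel n x b i = Re e * b i + Im e * a i" if "i < n" for i
    using arg_cong[OF comp[OF that], of Im] by (simp add: apply_kernel_def a_def b_def)
  have "\<exists>i<n. u $ i \<noteq> 0"
    using u by (metis carrier_vecD eq_vecI index_zero_vec)
  then obtain i0 where i0: "i0 < n" "a i0 \<noteq> 0 \<or> b i0 \<noteq> 0"
    by (auto simp: a_def b_def complex_eq_iff)
  have pos: "0 < (\<Sum>i<n. (g i)\<^sup>2)" if "g i0 \<noteq> 0" for g :: "nat \<Rightarrow> real"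
    using i0(1) that by (intro sum_pos2[of _ i0]) auto
  have nn: "0 \<le> (\<Sum>i<n. (g i)\<^sup>2)" for g :: "nat \<Rightarrow> real"
    by (simp add: sum_nonneg)
  have "(\<Sum>i<n. b i * (Re e * a i - Im e * b i)) = (\<Sum>i<n. (Re e * b i + Im e * a i) * a i)"
    using apply_kernel_selfadjoint[of n x b a] sym re im by simp
  then have "Im e * ((\<Sum>i<n. (a i)\<^sup>2) + (\<Sum>i<n. (b i)\<^sup>2)) = 0"
    by (simp add: algebra_simps sum.distrib sum_subtractf sum_distrib_left power2_eq_square)
  moreover have "(\<Sum>i<n. (a i)\<^sup>2) + (\<Sum>i<n. (b i)\<^sup>2) > 0"
    using i0(2) pos nn by (meson add_pos_nonneg add_nonneg_pos)
  ultimately have e: "Im e = 0" by simp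
  from i0(2) show ?thesis
  proof
    assume "a i0 \<noteq> 0"
    with e re pos show ?thesis by (intro that[of a]) auto
  next
    assume "b i0 \<noteq> 0"
    with e im pos show ?thesis by (intro that[of b]) auto
  qed
qed

section \<open>The two smallest diagonal entries\<close>

lemma sort_first_two:
  fixes xs :: "'a :: linorder list"
  assumes "length xs \<ge> 2"
  obtains i0 where "i0 < length xs" "xs ! i0 = sort xs ! 0"
    "\<And>i. i < length xs \<Longrightarrow> i \<noteq> i0 \<Longrightarrow> sort xs ! 1 \<le> xs ! i"
proof -
  obtain p where p: "p permutes {..<length xs}" "permute_list p xs = sort xs"
    using mset_eq_permutation[of "sort xs" xs] by auto
  have nth: "sort xs ! i = xs ! p i" if "i < length xs" for i
    using that p permute_list_nth by metis
  show ?thesis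
  proof (rule that[of "p 0"])
    have "0 \<in> {..<length xs}" using assms by auto
    then show "p 0 < length xs" using permutes_in_image[OF p(1), of 0] by simp
    show "xs ! p 0 = sort xs ! 0" using nth[of 0] assms by fastforce
  next
    fix i assume i: "i < length xs" "i \<noteq> p 0"
    obtain k where k: "k < length xs" "p k = i"
      using p(1) i by (metis lessThan_iff permutes_in_image permutes_surj surjE)
    with i have "k \<ge> 1" by (cases k) auto
    then have "sort xs ! 1 \<le> sort xs ! k"
      using k by (intro sorted_nth_mono) auto
    then show "sort xs ! 1 \<le> xs ! i" using nth k by simp
  qed
qed

text \<open>
  Let \<open>c\<close> be the entry of \<open>v\<close> at the position \<open>i0\<close> of the smallest diagonal entry and \<open>S\<close> the squared
  norm of the rest. If \<open>c\<^sup>2 \<le> S\<close>, the companion vector is \<open>\<bar>v\<bar>\<close>: both vectors put at most half of their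
  mass on \<open>i0\<close>. Otherwise \<open>v\<close> is too concentrated there, and its companion must have the masses of
  the two blocks exchanged. So it has \<open>\<surd>S\<close> at \<open>i0\<close>, and elsewhere \<open>\<bar>v\<bar>\<close> scaled to squared norm \<open>c\<^sup>2\<close>;
  together the two vectors then weigh \<open>i0\<close> and its complement equally. The off-diagonal products of
  \<open>v\<close> within the complement are compensated because \<open>c\<^sup>2 > S\<close>. If \<open>S = 0\<close>, there is no direction to
  scale, and any other coordinate vector serves.
\<close>

lemma extreme_eigenvalues_sum_ge:
  assumes n: "n \<ge> 2"
    and nonneg: "\<And>i j. i < n \<Longrightarrow> j < n \<Longrightarrow> 0 \<le> x i j"
    and upper: "\<And>f. quad_form n x f \<le> r * (\<Sum>i<n. (f i)\<^sup>2)"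
    and eigen: "\<And>i. i < n \<Longrightarrow> apply_kernel n x v i = m * v i"
    and v: "0 < (\<Sum>i<n. (v i)\<^sup>2)"
    and i0: "i0 < n" "b1 \<le> x i0 i0" and b12: "b1 \<le> b2"
    and b2: "\<And>i. i < n \<Longrightarrow> i \<noteq> i0 \<Longrightarrow> b2 \<le> x i i"
  shows "b1 + b2 \<le> r + m"
proof -
  define N where "N = (\<Sum>i<n. (v i)\<^sup>2)"
  define c where "c = v i0"
  define S where "S = (\<Sum>i\<in>{..<n}-{i0}. (v i)\<^sup>2)"
  have N: "N = c\<^sup>2 + S" unfolding N_def c_def S_def
    using i0 by (subst sum.remove[of _ i0]) auto
  have S: "S \<ge> 0" by (simp add: S_def sum_nonneg)
  have N0: "N > 0" using v by (simp add: N_def)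
  \<comment> \<open>The weight \<open>s\<close> lets the companion \<open>f\<close> be used without normalising it.\<close>
  have key: "b1 + b2 \<le> r + m"
    if off: "\<And>i j. i < n \<Longrightarrow> j < n \<Longrightarrow> i \<noteq> j \<Longrightarrow> 0 \<le> f i * f j + s * (v i * v j)"
      and s: "s > 0" and norm: "(\<Sum>i<n. (f i)\<^sup>2) = s * N"
      and w: "b1 * ((f i0)\<^sup>2 + s * c\<^sup>2) + b2 * (\<Sum>i\<in>{..<n}-{i0}. (f i)\<^sup>2 + s * (v i)\<^sup>2)
        \<ge> (b1 + b2) * (s * N)" for f s
  proof -
    have "(b1 + b2) * (s * N)
        \<le> b1 * ((f i0)\<^sup>2 + s * c\<^sup>2) + (\<Sum>i\<in>{..<n}-{i0}. b2 * ((f i)\<^sup>2 + s * (v i)\<^sup>2))"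
      using w by (simp only: sum_distrib_left)
    also have "\<dots> \<le> x i0 i0 * ((f i0)\<^sup>2 + s * c\<^sup>2)
        + (\<Sum>i\<in>{..<n}-{i0}. x i i * ((f i)\<^sup>2 + s * (v i)\<^sup>2))"
      using i0 b2 s by (intro add_mono sum_mono mult_right_mono) auto
    also have "\<dots> = (\<Sum>i<n. x i i * ((f i)\<^sup>2 + s * (v i)\<^sup>2))"
      using i0 by (subst (2) sum.remove[of _ i0]) (auto simp: c_def)
    also have "\<dots> \<le> quad_form n x f + s * quad_form n x v"
      using nonneg off by (rule quad_form_combination_ge_diagonal)
    also have "\<dots> \<le> r * (s * N) + s * (m * N)"
      using upper[of f] norm quad_form_eigenvector[OF eigen] by (simp add: N_def)
    finally have "(b1 + b2) * (s * N) \<le> (r + m) * (s * N)"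
      by (simp add: algebra_simps)
    then show ?thesis using s N0 by simp
  qed
  consider "c\<^sup>2 \<le> S" | "S = 0" "S < c\<^sup>2" | "S > 0" "S < c\<^sup>2"
    using S by linarith
  then show ?thesis
  proof cases
    case 1
    show ?thesis
    proof (rule key[of "\<lambda>i. \<bar>v i\<bar>" 1])
      fix i j
      show "0 \<le> \<bar>v i\<bar> * \<bar>v j\<bar> + 1 * (v i * v j)"
        using abs_ge_minus_self[of "v i * v j"] by (simp add: abs_mult)
    next
      have "0 \<le> (b2 - b1) * (S - c\<^sup>2)" using 1 b12 by simp
      then show "(b1 + b2) * (1 * N) \<le> b1 * (\<bar>v i0\<bar>\<^sup>2 + 1 * c\<^sup>2)
          + b2 * (\<Sum>i\<in>{..<n} - {i0}. \<bar>v i\<bar>\<^sup>2 + 1 * (v i)\<^sup>2)"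
        by (simp add: S_def[symmetric] c_def[symmetric] flip: sum_distrib_left) (simp add: N algebra_simps)
    qed (auto simp: N_def)
  next
    case 2
    have zero: "v i = 0" if "i < n" "i \<noteq> i0" for i
      using 2(1) that unfolding S_def by (subst (asm) sum_nonneg_eq_0_iff) auto
    obtain j0 where j0: "j0 < n" "j0 \<noteq> i0"
      using n that[of "if i0 = 0 then 1 else 0"] by (auto split: if_splits)
    let ?f = "\<lambda>i. if i = j0 then c else 0"
    have sq: "(?f i)\<^sup>2 = (if i = j0 then c\<^sup>2 else 0)" for i by simp
    show ?thesis
    proof (rule key[of ?f 1])
      fix i j assume "i < n" "j < n" "i \<noteq> j"
      then show "0 \<le> ?f i * ?f j + 1 * (v i * v j)"
        using zero[of i] zero[of j] by (cases "i = i0") auto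
    next
      show "(\<Sum>i<n. (?f i)\<^sup>2) = 1 * N" unfolding sq using j0 2 N by simp
    next
      show "(b1 + b2) * (1 * N) \<le> b1 * ((?f i0)\<^sup>2 + 1 * c\<^sup>2)
          + b2 * (\<Sum>i\<in>{..<n} - {i0}. (?f i)\<^sup>2 + 1 * (v i)\<^sup>2)"
        unfolding sq using j0 2
        by (simp add: sum.distrib flip: S_def) (simp add: N algebra_simps)
    qed auto
  next
    case 3
    \<comment> \<open>The companion of the case \<open>S < c\<^sup>2\<close>, multiplied by \<open>\<surd>S\<close> to avoid square roots.\<close>
    let ?f = "\<lambda>i. if i = i0 then S else \<bar>c\<bar> * \<bar>v i\<bar>"
    have rest: "(\<Sum>i\<in>{..<n}-{i0}. (?f i)\<^sup>2) = c\<^sup>2 * S"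
      unfolding S_def sum_distrib_left by (intro sum.cong) (auto simp: power_mult_distrib)
    show ?thesis
    proof (rule key[of ?f S])
      fix i j assume ij: "i < n" "j < n" "i \<noteq> j"
      have cross: "0 \<le> S * (\<bar>c\<bar> * \<bar>v k\<bar>) + S * (c * v k)" for k
        using S abs_ge_minus_self[of "c * v k"]
        by (simp add: abs_mult flip: distrib_left)
      have "\<bar>S * (v i * v j)\<bar> \<le> c\<^sup>2 * (\<bar>v i\<bar> * \<bar>v j\<bar>)"
        using 3 by (auto simp: abs_mult intro!: mult_right_mono)
      moreover have "(\<bar>c\<bar> * \<bar>v i\<bar>) * (\<bar>c\<bar> * \<bar>v j\<bar>) = \<bar>c\<bar>\<^sup>2 * (\<bar>v i\<bar> * \<bar>v j\<bar>)"
        by (simp only: power2_eq_square mult_ac)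
      ultimately have inner: "0 \<le> (\<bar>c\<bar> * \<bar>v i\<bar>) * (\<bar>c\<bar> * \<bar>v j\<bar>) + S * (v i * v j)"
        unfolding power2_abs by linarith
      show "0 \<le> ?f i * ?f j + S * (v i * v j)"
        using ij inner cross[of i] cross[of j] by (auto simp: c_def mult.commute)
    next
      show "(\<Sum>i<n. (?f i)\<^sup>2) = S * N"
      proof -
        have "(\<Sum>i<n. (?f i)\<^sup>2) = S\<^sup>2 + (\<Sum>i\<in>{..<n}-{i0}. (?f i)\<^sup>2)"
          using i0 by (subst sum.remove[of _ i0]) auto
        then show ?thesis unfolding rest by (simp add: N power2_eq_square algebra_simps)
      qed
    next
      have "(\<Sum>i\<in>{..<n} - {i0}. (?f i)\<^sup>2 + S * (v i)\<^sup>2) = c\<^sup>2 * S + S * S"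
        unfolding sum.distrib rest by (simp add: S_def flip: sum_distrib_left)
      then show "(b1 + b2) * (S * N) \<le> b1 * ((?f i0)\<^sup>2 + S * c\<^sup>2)
          + b2 * (\<Sum>i\<in>{..<n} - {i0}. (?f i)\<^sup>2 + S * (v i)\<^sup>2)"
        by (simp add: N power2_eq_square algebra_simps)
    qed (use 3 in auto)
  qed
qed

section \<open>Eigenvalue variance and the final bound\<close>

text \<open>
  Summing \<open>(r - e i) * (e i - m) \<ge> 0\<close> bounds the variance by \<open>(r - \<tau>) * (\<tau> - m)\<close>, where \<open>\<tau>\<close> is the mean;
  this product is largest when \<open>\<tau>\<close> is the midpoint.
\<close>

lemma sqrt_variance_le_half_range:
  fixes e :: "nat \<Rightarrow> real"
  assumes n: "n > 0" and e: "\<And>i. i < n \<Longrightarrow> m \<le> e i \<and> e i \<le> r"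
  shows "sqrt ((\<Sum>i<n. (e i)\<^sup>2) / real n - ((\<Sum>i<n. e i) / real n)\<^sup>2) \<le> (r - m) / 2"
proof (rule real_le_lsqrt)
  show "0 \<le> (r - m) / 2" using e[OF n] by simp
  define \<tau> where "\<tau> = (\<Sum>i<n. e i) / real n"
  have "0 \<le> (\<Sum>i<n. (r - e i) * (e i - m))"
    using e by (intro sum_nonneg) auto
  also have "\<dots> = (r + m) * (\<Sum>i<n. e i) - (\<Sum>i<n. (e i)\<^sup>2) - real n * (r * m)"
    by (simp add: algebra_simps sum.distrib sum_subtractf sum_distrib_left power2_eq_square)
  finally have "(\<Sum>i<n. (e i)\<^sup>2) \<le> (r + m) * (\<Sum>i<n. e i) - real n * (r * m)"
    by simp
  then have "(\<Sum>i<n. (e i)\<^sup>2) / real n \<le> ((r + m) * (\<Sum>i<n. e i) - real n * (r * m)) / real n"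
    by (intro divide_right_mono) auto
  also have "\<dots> = (r + m) * \<tau> - r * m"
    using n by (simp add: \<tau>_def field_simps)
  also have "\<dots> \<le> ((r - m) / 2)\<^sup>2 + \<tau>\<^sup>2"
    using zero_le_power2[of "\<tau> - (r + m) / 2"] by (simp add: power2_eq_square field_simps)
  finally show "(\<Sum>i<n. (e i)\<^sup>2) / real n - ((\<Sum>i<n. e i) / real n)\<^sup>2 \<le> ((r - m) / 2)\<^sup>2"
    by (simp add: \<tau>_def)
qed

theorem corollary2p6:
  fixes A X :: "complex mat" and n :: nat
  assumes "n \<ge> 2"
    and "A \<in> carrier_mat n n"
    and "nonneg_mat A"
    and "X = min_transpose A"
  shows "spectral_radius A \<ge>
      (sorted_diag A ! 0 + sorted_diag A ! 1) / 2
      + sqrt (Re (mat_trace (X ^\<^sub>m 2)) / real n - (Re (mat_trace X) / real n)\<^sup>2)"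
proof -
  note A = assms(2)
  have n: "n > 0" using assms(1) by simp
  define r where "r = spectral_radius A"
  define x where "x i j = min (Re (A $$ (i, j))) (Re (A $$ (j, i)))" for i j
  have X: "X = mat n n (\<lambda>(i, j). complex_of_real (x i j))"
    using A by (auto simp: assms(4) min_transpose_def x_def)
  have sym: "x i j = x j i" for i j by (simp add: x_def min.commute)
  have nonneg: "0 \<le> x i j" if "i < n" "j < n" for i j
    using assms(3) A that by (auto simp: nonneg_mat_def x_def less_eq_complex_def)
  have upper: "quad_form n x f \<le> r * (\<Sum>i<n. (f i)\<^sup>2)" for f
    unfolding r_def using A n assms(3) sym nonneg
    by (rule quad_form_le_spectral_radius) (auto simp: x_def)

  obtain e where e: "mat_trace X = (\<Sum>i<n. e i)" "mat_trace (X ^\<^sub>m 2) = (\<Sum>i<n. (e i)\<^sup>2)"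
    "\<And>i. i < n \<Longrightarrow> eigenvalue X (e i)"
    using traces_eq_eigenvalue_sums[of X n] X by auto
  have pair: "\<exists>v. Im (e i) = 0 \<and> (\<forall>j<n. apply_kernel n x v j = Re (e i) * v j) \<and> 0 < (\<Sum>j<n. (v j)\<^sup>2)"
    if "i < n" for i
    using real_eigenpair_of_symmetric[OF sym e(3)[OF that, unfolded X]] by metis
  have le_r: "Re (e i) \<le> r" if i: "i < n" for i
  proof -
    obtain v where v: "\<And>j. j < n \<Longrightarrow> apply_kernel n x v j = Re (e i) * v j"
      "0 < (\<Sum>j<n. (v j)\<^sup>2)"
      using pair[OF i] by blast
    have "Re (e i) * (\<Sum>j<n. (v j)\<^sup>2) \<le> r * (\<Sum>j<n. (v j)\<^sup>2)"
      using upper[of v] quad_form_eigenvector[OF v(1)] by simp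
    then show ?thesis using v(2) by simp
  qed
  define m where "m = Min ((\<lambda>i. Re (e i)) ` {..<n})"
  have "m \<in> (\<lambda>i. Re (e i)) ` {..<n}" unfolding m_def using n by (intro Min_in) auto
  then obtain k where k: "k < n" "m = Re (e k)" by auto
  obtain v where v: "\<And>j. j < n \<Longrightarrow> apply_kernel n x v j = m * v j" "0 < (\<Sum>j<n. (v j)\<^sup>2)"
    using pair[OF k(1)] k(2) by blast
  have m_le: "m \<le> Re (e i)" if "i < n" for i
    unfolding m_def using that by (intro Min_le) auto

  have len: "length (map Re (diag_mat A)) = n" using A by (simp add: diag_mat_def)
  obtain i0 where i0: "i0 < n" "map Re (diag_mat A) ! i0 = sorted_diag A ! 0"
    "\<And>i. i < n \<Longrightarrow> i \<noteq> i0 \<Longrightarrow> sorted_diag A ! 1 \<le> map Re (diag_mat A) ! i"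
    using sort_first_two[of "map Re (diag_mat A)"] assms(1) unfolding len sorted_diag_def by metis
  have diag: "map Re (diag_mat A) ! i = x i i" if "i < n" for i
    using that A by (simp add: diag_mat_def x_def)
  have "sorted_diag A ! 0 \<le> sorted_diag A ! 1"
    unfolding sorted_diag_def using len assms(1) by (intro sorted_nth_mono) auto
  then have sum_ge: "sorted_diag A ! 0 + sorted_diag A ! 1 \<le> r + m"
    using extreme_eigenvalues_sum_ge[OF assms(1) nonneg upper v, of i0] i0 diag by auto

  have "Re ((e i)\<^sup>2) = (Re (e i))\<^sup>2" if "i < n" for i
    using pair[OF that] by (auto simp: power2_eq_square)
  then have "Re (mat_trace X) = (\<Sum>i<n. Re (e i))" "Re (mat_trace (X ^\<^sub>m 2)) = (\<Sum>i<n. (Re (e i))\<^sup>2)"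
    using e by auto
  then have "sqrt (Re (mat_trace (X ^\<^sub>m 2)) / real n - (Re (mat_trace X) / real n)\<^sup>2) \<le> (r - m) / 2"
    using sqrt_variance_le_half_range[OF n, of m "\<lambda>i. Re (e i)" r] le_r m_le by simp
  with sum_ge show ?thesis by (simp add: r_def field_simps)
qed

end
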